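(* If $\Omega$ is a bounded open set in $\mathbb{R}^N$, then $$h_F(\Omega)\le\frac{N}{R_F(\Omega)}.$$ Moreover, equality holds if $\Omega$ is a Wulff shape.
   Context: Let $N\ge2$, $1<p<+\infty$, and let $F:\mathbb{R}^N\to[0,+\infty)$ be a convex function with $F(t\xi)=|t|F(\xi)$ for all $t\in\mathbb R$, $\xi\in\mathbb{R}^N$, with $a|\xi|\le F(\xi)$ for some constant $a>0$, with $F\in C^{3,\beta}(\mathbb{R}^N\setminus\{0\})$, and such that the Hessian $[F^p]_{\xi\xi}(\xi)$ is positive definite for every $\xi\neq0$. The polar function is $F^o(v)=\sup_{\xi\ne0}\frac{\langle\xi,v\rangle}{F(\xi)}$. Wulff shapes are the sets $\mathcal W_r(x_0)=\{x\in\mathbb{R}^N:F^o(x-x_0)<r\}$, $r>0$, $x_0\in\mathbb{R}^N$. Anisotropic inradius: $d_F(x)=\inf_{y\in\partial\Omega}F^o(x-y)$ for $x\in\overline\Omega$, and $R_F(\Omega)=\sup_{x\in\Omega}d_F(x)$. Anisotropic perimeter: $P_F(K)=\sup\left\{\int_K\operatorname{div}\sigma\,dx:\ \sigma\in C_0^1(\mathbb{R}^N;\mathbb{R}^N),\ F^o(\sigma)\le1\right\}$. Anisotropic Cheeger constant: $h_F(\Omega)=\inf_{K\subset\Omega}\frac{P_F(K)}{|K|}$ (over measurable $K$ with $|K|>0$). *)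

theory Defs
  imports "HOL-Analysis.Analysis"
begin

definition partial_deriv :: "'n::finite \<Rightarrow> (real^'n \<Rightarrow> 'b::real_normed_vector) \<Rightarrow> real^'n \<Rightarrow> 'b"
  where "partial_deriv i f x = frechet_derivative f (at x) (axis i 1)"

primrec iterated_partial ::
  "'n::finite list \<Rightarrow> (real^'n \<Rightarrow> 'b::real_normed_vector) \<Rightarrow> real^'n \<Rightarrow> 'b"
  where
    "iterated_partial [] f = f"
  | "iterated_partial (i # js) f = partial_deriv i (iterated_partial js f)"

(* Meant for open S. frechet_derivative is total, so differentiability of the lower-order
   partial derivatives is demanded explicitly. *)
definition C_k_on :: "nat \<Rightarrow> (real^'n::finite \<Rightarrow> 'b::real_normed_vector) \<Rightarrow> (real^'n) set \<Rightarrow> bool"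
  where "C_k_on k f S \<longleftrightarrow>
    (\<forall>js. length js < k \<longrightarrow> (\<forall>x\<in>S. iterated_partial js f differentiable (at x))) \<and>
    (\<forall>js. length js \<le> k \<longrightarrow> continuous_on S (iterated_partial js f))"

(* The Hoelder condition is local (uniform on compact subsets of S): the third derivatives of
   a 1-homogeneous function are (-2)-homogeneous, hence not uniformly Hoelder
   on the punctured space unless they vanish. *)
definition C_k_holder_on ::
  "nat \<Rightarrow> real \<Rightarrow> (real^'n::finite \<Rightarrow> 'b::real_normed_vector) \<Rightarrow> (real^'n) set \<Rightarrow> bool"
  where "C_k_holder_on k \<beta> f S \<longleftrightarrow> C_k_on k f S \<and>
    (\<forall>js. length js = k \<longrightarrow>
      (\<forall>K. compact K \<and> K \<subseteq> S \<longrightarrow>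
        (\<exists>C. \<forall>x\<in>K. \<forall>y\<in>K.
          dist (iterated_partial js f x) (iterated_partial js f y) \<le> C * dist x y powr \<beta>)))"

definition hessian :: "(real^'n::finite \<Rightarrow> real) \<Rightarrow> real^'n \<Rightarrow> real^'n^'n"
  where "hessian f x = (\<chi> i j. partial_deriv i (partial_deriv j f) x)"

definition positive_definite :: "real^'n::finite^'n \<Rightarrow> bool"
  where "positive_definite A \<longleftrightarrow> (\<forall>v. v \<noteq> 0 \<longrightarrow> 0 < v \<bullet> (A *v v))"

definition divergence :: "(real^'n::finite \<Rightarrow> real^'n) \<Rightarrow> real^'n \<Rightarrow> real"
  where "divergence \<sigma> x = (\<Sum>i\<in>UNIV. partial_deriv i (\<lambda>y. \<sigma> y $ i) x)"

definition polar :: "(real^'n::finite \<Rightarrow> real) \<Rightarrow> real^'n \<Rightarrow> real"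
  where "polar F v = (SUP \<xi>\<in>-{0}. (\<xi> \<bullet> v) / F \<xi>)"

definition wulff_shape :: "(real^'n::finite \<Rightarrow> real) \<Rightarrow> real \<Rightarrow> real^'n \<Rightarrow> (real^'n) set"
  where "wulff_shape F r x0 = {x. polar F (x - x0) < r}"

definition aniso_dist :: "(real^'n::finite \<Rightarrow> real) \<Rightarrow> (real^'n) set \<Rightarrow> real^'n \<Rightarrow> real"
  where "aniso_dist F \<Omega> x = (INF y\<in>frontier \<Omega>. polar F (x - y))"

(* The inradius, perimeter and Cheeger constant are nonnegative and possibly infinite, hence
   ennreal. In particular the empty set has inradius 0 and Cheeger constant \<infinity>. *)
definition aniso_inradius :: "(real^'n::finite \<Rightarrow> real) \<Rightarrow> (real^'n) set \<Rightarrow> ennreal"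
  where "aniso_inradius F \<Omega> = (SUP x\<in>\<Omega>. ennreal (aniso_dist F \<Omega> x))"

(* The truncation of negative values by ennreal does not change the supremum,
   since \<sigma> = 0 is admissible. *)
definition aniso_perimeter :: "(real^'n::finite \<Rightarrow> real) \<Rightarrow> (real^'n) set \<Rightarrow> ennreal"
  where "aniso_perimeter F K =
    (SUP \<sigma>\<in>{\<sigma>. C_k_on 1 \<sigma> UNIV \<and> compact (closure {x. \<sigma> x \<noteq> 0}) \<and> (\<forall>x. polar F (\<sigma> x) \<le> 1)}.
      ennreal (LINT x:K|lebesgue. divergence \<sigma> x))"

definition aniso_cheeger :: "(real^'n::finite \<Rightarrow> real) \<Rightarrow> (real^'n) set \<Rightarrow> ennreal"
  where "aniso_cheeger F \<Omega> =
    (INF K\<in>{K. K \<in> sets lebesgue \<and> K \<subseteq> \<Omega> \<and> 0 < emeasure lebesgue K}.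
      aniso_perimeter F K / emeasure lebesgue K)"

end

theory Submission
  imports Defs
begin

text \<open>
  Let \<open>W\<close> be a Wulff shape of radius \<open>r\<close> and \<open>\<sigma>\<close> an admissible field. Since the polar
  function is subadditive, the map \<open>x \<mapsto> x + t \<sigma>(x)\<close> sends \<open>W\<close> into the concentric
  Wulff shape of radius \<open>r + t\<close>, whose volume is \<open>(1 + t / r)^N |W|\<close>; for small \<open>t > 0\<close> it is injective,
  so its image has volume \<open>|W| + t \<integral>\<^sub>W div \<sigma> + O(t^2)\<close>. Comparing the first-order terms gives
  \<open>\<integral>\<^sub>W div \<sigma> \<le> (N / r) |W|\<close> without any divergence theorem, that is \<open>P\<^sub>F(W) / |W| \<le> N / r\<close>.
  An open set contains the Wulff shape of radius \<open>d\<^sub>F(x)\<close> around each of its points \<open>x\<close>, which yields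
  the inequality. Conversely, for \<open>K \<subseteq> W\<close> the field \<open>(1 - \<epsilon>) (x - x\<^sub>0) / r\<close>, cut off
  outside \<open>W\<close>, has divergence \<open>(1 - \<epsilon>) N / r\<close> on \<open>K\<close>; the factor \<open>1 - \<epsilon>\<close> leaves room for
  the cutoff within the constraint \<open>F\<^sup>o(\<sigma>) \<le> 1\<close>.
\<close>

subsection \<open>First-order expansion of the determinant\<close>

text \<open>The uniform expansion \<open>f t x = c + t * l x + O(t^2)\<close> on \<open>P\<close>.
  One constant serves every \<open>x\<close>, so the error can later be integrated over a set; the
  bound on \<open>l\<close> is included so that products remain expansions of the same kind.\<close>

definition first_order_on :: "'a set \<Rightarrow> (real \<Rightarrow> 'a \<Rightarrow> real) \<Rightarrow> real \<Rightarrow> ('a \<Rightarrow> real) \<Rightarrow> bool"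
  where "first_order_on P f c l \<longleftrightarrow>
    (\<exists>C. \<forall>t\<in>{0..1}. \<forall>x\<in>P. \<bar>l x\<bar> \<le> C \<and> \<bar>f t x - c - t * l x\<bar> \<le> C * t\<^sup>2)"

lemma first_order_on_mult:
  assumes "first_order_on P f c l" "first_order_on P g d m"
  shows "first_order_on P (\<lambda>t x. f t x * g t x) (c * d) (\<lambda>x. c * m x + d * l x)"
proof -
  obtain C where C: "\<And>t x. t \<in> {0..1} \<Longrightarrow> x \<in> P \<Longrightarrow> \<bar>l x\<bar> \<le> C \<and> \<bar>f t x - c - t * l x\<bar> \<le> C * t\<^sup>2"
    using assms(1) unfolding first_order_on_def by blast
  obtain D where D: "\<And>t x. t \<in> {0..1} \<Longrightarrow> x \<in> P \<Longrightarrow> \<bar>m x\<bar> \<le> D \<and> \<bar>g t x - d - t * m x\<bar> \<le> D * t\<^sup>2"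
    using assms(2) unfolding first_order_on_def by blast
  \<comment> \<open>The first two summands bound the new linear coefficient; the other three are the
    coefficients of the three error terms in \<open>eq\<close> below.\<close>
  define E where "E = \<bar>c\<bar> * D + \<bar>d\<bar> * C + C * (\<bar>d\<bar> + 2 * D) + (\<bar>c\<bar> + C) * D + C * D"
  have "\<bar>c * m x + d * l x\<bar> \<le> E \<and>
      \<bar>f t x * g t x - c * d - t * (c * m x + d * l x)\<bar> \<le> E * t\<^sup>2"
    if t: "t \<in> {0..1}" and x: "x \<in> P" for t x
  proof -
    have l: "\<bar>l x\<bar> \<le> C" and f: "\<bar>f t x - c - t * l x\<bar> \<le> C * t\<^sup>2"
      and m: "\<bar>m x\<bar> \<le> D" and g: "\<bar>g t x - d - t * m x\<bar> \<le> D * t\<^sup>2"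
      using C[OF t x] D[OF t x] by auto
    have C0: "0 \<le> C" and D0: "0 \<le> D" using l m by linarith+
    have t2: "0 \<le> t\<^sup>2" "t\<^sup>2 \<le> 1" "0 \<le> t" "t \<le> 1" using t by (auto simp: power_le_one)
    have "\<bar>t * m x\<bar> \<le> 1 * D" "\<bar>t * l x\<bar> \<le> 1 * C"
      unfolding abs_mult using t2 m l by (intro mult_mono; simp)+
    moreover have "D * t\<^sup>2 \<le> D" using D0 t2 by (simp add: mult_left_le)
    ultimately have g2: "\<bar>g t x\<bar> \<le> \<bar>d\<bar> + 2 * D" and cl: "\<bar>c + t * l x\<bar> \<le> \<bar>c\<bar> + C"
      using g by linarith+
    have 1: "\<bar>c * m x\<bar> \<le> \<bar>c\<bar> * D" "\<bar>d * l x\<bar> \<le> \<bar>d\<bar> * C"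
      unfolding abs_mult using m l by (intro mult_left_mono; simp)+
    have *: "0 \<le> C * (\<bar>d\<bar> + 2 * D) + (\<bar>c\<bar> + C) * D + C * D"
      using C0 D0 by (intro add_nonneg_nonneg mult_nonneg_nonneg) auto
    have **: "0 \<le> \<bar>c\<bar> * D + \<bar>d\<bar> * C" using C0 D0 by (intro add_nonneg_nonneg mult_nonneg_nonneg) auto
    \<comment> \<open>The error splits into each factor's own error times a bounded quantity, plus
      the product of the two linear terms, which is already of order \<open>t^2\<close>.\<close>
    have eq: "f t x * g t x - c * d - t * (c * m x + d * l x) =
        (f t x - c - t * l x) * g t x + (c + t * l x) * (g t x - d - t * m x) + t\<^sup>2 * (l x * m x)"
      by (simp add: algebra_simps power2_eq_square)
    have a: "\<bar>(f t x - c - t * l x) * g t x\<bar> \<le> (C * t\<^sup>2) * (\<bar>d\<bar> + 2 * D)"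
      unfolding abs_mult using f g2 C0 t2 by (intro mult_mono) auto
    have b: "\<bar>(c + t * l x) * (g t x - d - t * m x)\<bar> \<le> (\<bar>c\<bar> + C) * (D * t\<^sup>2)"
      unfolding abs_mult using g cl C0 t2 by (intro mult_mono) auto
    have e: "\<bar>t\<^sup>2 * (l x * m x)\<bar> \<le> t\<^sup>2 * (C * D)"
      unfolding abs_mult using l m C0 t2 by (intro mult_mono) auto
    have "\<bar>f t x * g t x - c * d - t * (c * m x + d * l x)\<bar> \<le>
        (C * t\<^sup>2) * (\<bar>d\<bar> + 2 * D) + (\<bar>c\<bar> + C) * (D * t\<^sup>2) + t\<^sup>2 * (C * D)"
      unfolding eq using a b e by linarith
    also have "\<dots> = (C * (\<bar>d\<bar> + 2 * D) + (\<bar>c\<bar> + C) * D + C * D) * t\<^sup>2" by (simp add: algebra_simps)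
    also have "\<dots> \<le> E * t\<^sup>2" unfolding E_def using ** t2 by (intro mult_right_mono) auto
    finally show ?thesis using 1 * ** unfolding E_def by (auto intro: order_trans[OF abs_triangle_ineq])
  qed
  then show ?thesis unfolding first_order_on_def by blast
qed

lemma first_order_on_add:
  assumes "first_order_on P f c l" "first_order_on P g d m"
  shows "first_order_on P (\<lambda>t x. f t x + g t x) (c + d) (\<lambda>x. l x + m x)"
proof -
  obtain C where C: "\<And>t x. t \<in> {0..1} \<Longrightarrow> x \<in> P \<Longrightarrow> \<bar>l x\<bar> \<le> C \<and> \<bar>f t x - c - t * l x\<bar> \<le> C * t\<^sup>2"
    using assms(1) unfolding first_order_on_def by blast
  obtain D where D: "\<And>t x. t \<in> {0..1} \<Longrightarrow> x \<in> P \<Longrightarrow> \<bar>m x\<bar> \<le> D \<and> \<bar>g t x - d - t * m x\<bar> \<le> D * t\<^sup>2"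
    using assms(2) unfolding first_order_on_def by blast
  have "\<bar>l x + m x\<bar> \<le> C + D \<and>
      \<bar>f t x + g t x - (c + d) - t * (l x + m x)\<bar> \<le> (C + D) * t\<^sup>2"
    if t: "t \<in> {0..1}" and x: "x \<in> P" for t x
    using C[OF t x] D[OF t x] by (simp add: distrib_left distrib_right) linarith
  then show ?thesis unfolding first_order_on_def by blast
qed

lemma first_order_on_affine:
  assumes "\<And>x. x \<in> P \<Longrightarrow> \<bar>l x\<bar> \<le> B"
  shows "first_order_on P (\<lambda>t x. c + t * l x) c l"
  unfolding first_order_on_def
proof (intro exI ballI conjI)
  fix t :: real and x assume x: "x \<in> P"
  then show "\<bar>l x\<bar> \<le> \<bar>B\<bar>" using assms by fastforce
  show "\<bar>c + t * l x - c - t * l x\<bar> \<le> \<bar>B\<bar> * t\<^sup>2" by simp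
qed

lemma first_order_on_const: "first_order_on P (\<lambda>t x. c) c (\<lambda>x. 0)"
  using first_order_on_affine[of P "\<lambda>x. 0" 0 c] by simp

lemma first_order_on_sum:
  assumes "finite I" "\<And>i. i \<in> I \<Longrightarrow> first_order_on P (f i) (c i) (l i)"
  shows "first_order_on P (\<lambda>t x. \<Sum>i\<in>I. f i t x) (\<Sum>i\<in>I. c i) (\<lambda>x. \<Sum>i\<in>I. l i x)"
  using assms
  by (induction I rule: finite_induct) (auto intro!: first_order_on_const first_order_on_add)

text \<open>The Leibniz rule, by induction on \<open>I\<close>. The coefficient uses products over
  \<open>I - {i}\<close> instead of quotients because the \<open>c j\<close> may vanish, as they do
  for off-diagonal matrix entries.\<close>

lemma first_order_on_prod:
  assumes "finite I" "\<And>i. i \<in> I \<Longrightarrow> first_order_on P (f i) (c i) (l i)"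
  shows "first_order_on P (\<lambda>t x. \<Prod>i\<in>I. f i t x) (\<Prod>i\<in>I. c i) (\<lambda>x. \<Sum>i\<in>I. l i x * (\<Prod>j\<in>I - {i}. c j))"
  using assms
proof (induction I rule: finite_induct)
  case empty
  show ?case by (simp add: first_order_on_const)
next
  case (insert k I)
  have eq: "c k * (\<Sum>i\<in>I. l i x * (\<Prod>j\<in>I - {i}. c j)) + (\<Prod>i\<in>I. c i) * l k x
      = (\<Sum>i\<in>insert k I. l i x * (\<Prod>j\<in>insert k I - {i}. c j))" for x
  proof -
    have "(\<Prod>j\<in>insert k I - {i}. c j) = c k * (\<Prod>j\<in>I - {i}. c j)" if "i \<in> I" for i
    proof -
      have "insert k I - {i} = insert k (I - {i})" using that insert by auto
      then show ?thesis using insert by simp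
    qed
    moreover have "insert k I - {k} = I" using insert by auto
    ultimately show ?thesis using insert by (simp add: sum_distrib_left mult_ac)
  qed
  have "first_order_on P (\<lambda>t x. f k t x * (\<Prod>i\<in>I. f i t x)) (c k * (\<Prod>i\<in>I. c i))
     (\<lambda>x. c k * (\<Sum>i\<in>I. l i x * (\<Prod>j\<in>I - {i}. c j)) + (\<Prod>i\<in>I. c i) * l k x)"
    using insert by (intro first_order_on_mult) auto
  then show ?case using insert unfolding eq by simp
qed

text \<open>Each summand of the permutation expansion is a product of affine functions of
  \<open>t\<close>. Bounding the entries by \<open>B\<close> makes the error uniform over the
  matrices.\<close>

lemma first_order_on_det:
  "first_order_on {A :: real^'n^'n. \<forall>i j. \<bar>A$i$j\<bar> \<le> B} (\<lambda>t A. det (mat 1 + t *\<^sub>R A)) 1 trace"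
proof -
  let ?P = "{A :: real^'n^'n. \<forall>i j. \<bar>A$i$j\<bar> \<le> B}"
  let ?c = "\<lambda>p i :: 'n. if i = p i then 1 else 0 :: real"
  let ?l = "\<lambda>p (A :: real^'n^'n). \<Sum>i\<in>UNIV. A$i$p i * (\<Prod>j\<in>UNIV - {i}. ?c p j)"
  let ?S = "{p. p permutes (UNIV :: 'n set)}"
  have "first_order_on ?P (\<lambda>t A. \<Prod>i\<in>UNIV. ?c p i + t * A$i$p i) (\<Prod>i\<in>UNIV. ?c p i) (?l p)" for p
    by (intro first_order_on_prod first_order_on_affine[where B = B]) auto
  then have "first_order_on ?P
      (\<lambda>t A. \<Sum>p\<in>?S. of_int (sign p) * (\<Prod>i\<in>UNIV. ?c p i + t * A$i$p i))
      (\<Sum>p\<in>?S. of_int (sign p) * (\<Prod>i\<in>UNIV. ?c p i))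
      (\<lambda>A. \<Sum>p\<in>?S. of_int (sign p) * ?l p A + (\<Prod>i\<in>UNIV. ?c p i) * 0)"
    by (intro first_order_on_sum first_order_on_mult first_order_on_const) auto
  moreover have "(\<Sum>p\<in>?S. of_int (sign p) * (\<Prod>i\<in>UNIV. ?c p i + t * A$i$p i)) = det (mat 1 + t *\<^sub>R A)"
    for t and A :: "real^'n^'n"
    unfolding det_def by (simp add: mat_def)
  moreover have "(\<Sum>p\<in>?S. of_int (sign p) * (\<Prod>i\<in>UNIV. ?c p i)) = 1"
    using det_I[where 'a = real and 'n = 'n] unfolding det_def by (simp add: mat_def)
  moreover have "(\<Sum>p\<in>?S. of_int (sign p) * ?l p A + (\<Prod>i\<in>UNIV. ?c p i) * 0) = trace A"
    for A :: "real^'n^'n"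
  proof -
    \<comment> \<open>A permutation other than the identity moves at least two indices. Removing the
      factor at \<open>i\<close> therefore leaves a vanishing factor, so only the identity
      contributes at first order.\<close>
    have z: "?l p A = 0" if p: "p \<in> ?S" "p \<noteq> id" for p
    proof (rule sum.neutral, intro ballI)
      fix i :: 'n
      have "inj p" using p permutes_inj by auto
      obtain j where j: "p j \<noteq> j" using p(2) by (metis eq_id_iff)
      have "\<exists>k. k \<noteq> i \<and> p k \<noteq> k"
        using \<open>inj p\<close> j by (cases "j = i") (metis injD)+
      then obtain k where "k \<noteq> i" "p k \<noteq> k" by auto
      then have "(\<Prod>j\<in>UNIV - {i}. ?c p j) = 0"
        by (intro prod_zero bexI[of _ k]) auto
      then show "A$i$p i * (\<Prod>j\<in>UNIV - {i}. ?c p j) = 0" by simp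
    qed
    have "(\<Sum>p\<in>?S. of_int (sign p) * ?l p A + (\<Prod>i\<in>UNIV. ?c p i) * 0) =
        (\<Sum>p\<in>{id}. of_int (sign p) * ?l p A)"
      using z by (intro sum.mono_neutral_cong_right) (auto simp: permutes_id)
    also have "\<dots> = trace A" by (simp add: trace_def)
    finally show ?thesis .
  qed
  ultimately show ?thesis by (simp only:)
qed

subsection \<open>First variation of volume\<close>

text \<open>
  The library's change-of-variables theorem is restricted to coordinate types of class
  \<^class>\<open>wellorder\<close>. An arbitrary finite index type is enumerated by the following type in
  order to remove this restriction.
\<close>

typedef ('n::finite) ordered_index = "{..<CARD('n)}"
  by (rule exI[of _ 0]) simp

instantiation ordered_index :: (finite) "{finite, wellorder}"
begin

definition less_eq_ordered_index :: "'a ordered_index \<Rightarrow> 'a ordered_index \<Rightarrow> bool"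
  where "x \<le> y \<longleftrightarrow> Rep_ordered_index x \<le> Rep_ordered_index y"

definition less_ordered_index :: "'a ordered_index \<Rightarrow> 'a ordered_index \<Rightarrow> bool"
  where "x < y \<longleftrightarrow> Rep_ordered_index x < Rep_ordered_index y"

instance
proof
  have "finite (range (Rep_ordered_index :: 'a ordered_index \<Rightarrow> nat))"
    using Rep_ordered_index by (auto intro: finite_subset[of _ "{..<CARD('a)}"])
  then show "finite (UNIV :: 'a ordered_index set)"
    by (rule finite_imageD) (simp add: inj_on_def Rep_ordered_index_inject)
  fix P :: "'a ordered_index \<Rightarrow> bool" and a
  assume "\<And>x. (\<And>y. y < x \<Longrightarrow> P y) \<Longrightarrow> P x"
  then show "P a"
    unfolding less_ordered_index_def
    by (induction "Rep_ordered_index a" arbitrary: a rule: less_induct) blast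
qed (auto simp: less_eq_ordered_index_def less_ordered_index_def Rep_ordered_index_inject)

end

lemma ex_bij_ordered_index: "\<exists>\<pi> :: 'n::finite ordered_index \<Rightarrow> 'n. bij \<pi>"
proof -
  have "card (UNIV :: 'n ordered_index set) = CARD('n)"
    using type_definition.card[OF type_definition_ordered_index[where 'n = 'n]] by simp
  then show ?thesis
    by (metis bij_betw_iff_card finite)
qed

text \<open>The volume comparison, detached from Wulff shapes: \<open>incl\<close> places the
  perturbed set in a translate of the dilated set. Convexity turns the derivative bound
  \<open>bd\<close> into a Lipschitz bound, which makes the perturbed map injective for small
  \<open>t\<close>.\<close>

lemma integral_trace_derivative_le_wellorder:
  fixes K :: "(real^'n::{finite,wellorder}) set" and \<sigma> :: "real^'n::_ \<Rightarrow> real^'n::_"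
  assumes K: "open K" "convex K" "bounded K"
    and der: "\<And>x. x \<in> K \<Longrightarrow> (\<sigma> has_derivative \<sigma>' x) (at x)"
    and bd: "\<And>x v. x \<in> K \<Longrightarrow> norm (\<sigma>' x v) \<le> B * norm v"
    and int: "(\<lambda>x. trace (matrix (\<sigma>' x))) integrable_on K"
    and c: "0 \<le> c"
    and incl: "\<And>t. 0 < t \<Longrightarrow> \<exists>v. (\<lambda>x. x + t *\<^sub>R \<sigma> x) ` K \<subseteq> (\<lambda>x. (1 + t * c) *\<^sub>R x + v) ` K"
  shows "integral K (\<lambda>x. trace (matrix (\<sigma>' x))) \<le> real CARD('n) * c * measure lebesgue K"
proof -
  let ?m = "measure lebesgue K" and ?I = "integral K (\<lambda>x. trace (matrix (\<sigma>' x)))"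
  have Kl: "K \<in> sets lebesgue" using K by (simp add: borel_open)
  have Km: "K \<in> lmeasurable" using K Kl by (simp add: bounded_set_imp_lmeasurable)
  obtain C where C: "\<And>t A. t \<in> {0..1} \<Longrightarrow> (\<forall>i j. \<bar>A$i$j\<bar> \<le> B) \<Longrightarrow>
      \<bar>det (mat 1 + t *\<^sub>R (A :: ((real, 'n) vec, 'n) vec)) - 1 - t * trace A\<bar> \<le> C * t\<^sup>2"
    using first_order_on_det[where 'n = 'n and B = B] unfolding first_order_on_def by blast
  have entries: "\<bar>matrix (\<sigma>' x)$i$j\<bar> \<le> B" if "x \<in> K" for x i j
    using component_le_norm_cart[of "\<sigma>' x (axis j 1)" i] bd[OF that, of "axis j 1"]
    by (simp add: matrix_def)
  \<comment> \<open>The bound \<open>1\<close> keeps \<open>t\<close> in the range of the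
    determinant expansion; the other bound gives \<open>t * \<bar>B\<bar> < 1\<close>, needed for
    injectivity.\<close>
  define \<delta> where "\<delta> = min 1 (1 / (\<bar>B\<bar> + 1))"
  have \<delta>: "0 < \<delta>" by (simp add: \<delta>_def)
  have bound: "?I \<le> ?m * (((1 + t * c) ^ CARD('n) - 1) / t + C * t)" if t: "0 < t" "t < \<delta>" for t
  proof -
    let ?g = "\<lambda>x. x + t *\<^sub>R \<sigma> x" and ?g' = "\<lambda>x v. v + t *\<^sub>R \<sigma>' x v"
    have t1: "t \<in> {0..1}" "t * \<bar>B\<bar> < 1"
    proof -
      have "\<delta> \<le> 1" unfolding \<delta>_def by (rule min.cobounded1)
      then show "t \<in> {0..1}" using t by simp
      have "t * (\<bar>B\<bar> + 1) < 1" using t by (simp add: \<delta>_def field_simps)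
      then show "t * \<bar>B\<bar> < 1" using t by (simp add: algebra_simps)
    qed
    have dg: "(?g has_derivative ?g' x) (at x within K)" if "x \<in> K" for x
      by (intro has_derivative_add has_derivative_ident has_derivative_scaleR_right
          has_derivative_at_withinI[OF der[OF that]])
    have lip: "norm (\<sigma> x - \<sigma> y) \<le> \<bar>B\<bar> * norm (x - y)" if "x \<in> K" "y \<in> K" for x y
    proof (rule differentiable_bound[OF K(2) _ _ that])
      fix x assume x: "x \<in> K"
      then show "(\<sigma> has_derivative \<sigma>' x) (at x within K)" using der has_derivative_at_withinI by blast
      have "norm (\<sigma>' x v) \<le> \<bar>B\<bar> * norm v" for v
        using bd[OF x, of v] by (rule order_trans) (simp add: mult_right_mono)
      then show "onorm (\<sigma>' x) \<le> \<bar>B\<bar>" by (rule onorm_le)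
    qed
    \<comment> \<open>The perturbation \<open>t *\<^sub>R \<sigma> x\<close> is a contraction, hence
      cannot cancel the difference of two distinct points.\<close>
    have inj: "inj_on ?g K"
    proof (rule inj_onI)
      fix x y assume xy: "x \<in> K" "y \<in> K" and "?g x = ?g y"
      then have eq: "x - y = t *\<^sub>R (\<sigma> y - \<sigma> x)" by (simp add: algebra_simps)
      have "norm (x - y) = t * norm (\<sigma> y - \<sigma> x)" unfolding eq using t by simp
      also have "\<dots> \<le> t * (\<bar>B\<bar> * norm (x - y))"
        using lip[OF xy] t by (simp add: norm_minus_commute)
      finally have "(1 - t * \<bar>B\<bar>) * norm (x - y) \<le> 0" by (simp add: algebra_simps)
      then show "x = y" using t1 by (simp add: mult_le_0_iff)
    qed
    obtain v where v: "?g ` K \<subseteq> (\<lambda>x. (1 + t * c) *\<^sub>R x + v) ` K" using incl t by blast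
    let ?h = "\<lambda>x. (1 + t * c) *\<^sub>R x + v"
    have bh: "bounded (?h ` K)"
      using bounded_translation[OF bounded_scaling[OF K(3), of "1 + t * c"], of v]
      by (simp add: image_image add.commute)
    have hK: "?h ` K \<in> lmeasurable"
    proof (rule bounded_set_imp_lmeasurable[OF bh])
      show "?h ` K \<in> sets lebesgue"
        by (rule differentiable_image_in_sets_lebesgue[OF Kl])
           (auto intro!: derivative_intros)
    qed
    have gK: "?g ` K \<in> lmeasurable"
    proof (rule bounded_set_imp_lmeasurable[OF bounded_subset[OF bh v]])
      show "?g ` K \<in> sets lebesgue"
        using dg by (intro differentiable_image_in_sets_lebesgue[OF Kl])
           (auto simp: differentiable_on_def differentiable_def)
    qed
    have mat: "matrix (?g' x) = mat 1 + t *\<^sub>R matrix (\<sigma>' x)" for x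
      by (simp add: matrix_def mat_def vec_eq_iff axis_def)
    have 1: "((\<lambda>x. \<bar>det (mat 1 + t *\<^sub>R matrix (\<sigma>' x))\<bar>) has_integral measure lebesgue (?g ` K)) K"
      using has_measure_differentiable_image[OF Kl dg inj] gK unfolding mat by blast
    have one: "((\<lambda>x. 1::real) has_integral ?m) K"
      using Km lmeasure_integral[of K] lmeasurable_iff_integrable_on[of K]
      by (simp add: has_integral_iff)
    have 2: "((\<lambda>x. (1 - C * t\<^sup>2) * 1 + t * trace (matrix (\<sigma>' x))) has_integral
        (1 - C * t\<^sup>2) * ?m + t * ?I) K"
      by (intro has_integral_add has_integral_mult_right one integrable_integral int)
    \<comment> \<open>The integral of the Jacobian is bounded below by that of its expansion
      \<open>1 + t * trace - C * t^2\<close>.\<close>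
    have "(1 - C * t\<^sup>2) * ?m + t * ?I \<le> measure lebesgue (?g ` K)"
    proof (rule has_integral_le[OF 2 1])
      fix x assume "x \<in> K"
      then show "(1 - C * t\<^sup>2) * 1 + t * trace (matrix (\<sigma>' x)) \<le> \<bar>det (mat 1 + t *\<^sub>R matrix (\<sigma>' x))\<bar>"
        using C[OF t1(1), of "matrix (\<sigma>' x)"] entries by fastforce
    qed
    also have "\<dots> \<le> measure lebesgue (?h ` K)"
      using gK hK v by (simp add: measure_mono_fmeasurable fmeasurableD)
    also have "\<dots> = (1 + t * c) ^ CARD('n) * ?m"
      using measure_lebesgue_affine[of "1 + t * c" v K] t c by simp
    finally have "t * ?I \<le> ?m * ((1 + t * c) ^ CARD('n) - 1 + C * t\<^sup>2)" by (simp add: algebra_simps)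
    then have "?I \<le> ?m * ((1 + t * c) ^ CARD('n) - 1 + C * t\<^sup>2) / t"
      using t by (simp add: pos_le_divide_eq mult.commute)
    also have "\<dots> = ?m * (((1 + t * c) ^ CARD('n) - 1) / t + C * t)"
      using t by (simp add: field_simps power2_eq_square)
    finally show ?thesis .
  qed
  \<comment> \<open>As \<open>t\<close> decreases to \<open>0\<close>, the difference quotient tends
    to the derivative of the dilation factor and the error \<open>C * t\<close> disappears.\<close>
  have "((\<lambda>t. (1 + t * c) ^ CARD('n)) has_real_derivative real CARD('n) * c) (at 0)"
    by (auto intro!: derivative_eq_intros)
  then have "((\<lambda>t. ((1 + t * c) ^ CARD('n) - 1) / t) \<longlongrightarrow> real CARD('n) * c) (at_right 0)"
    by (auto simp: has_field_derivative_iff intro: tendsto_within_subset)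
  then have "((\<lambda>t. ?m * (((1 + t * c) ^ CARD('n) - 1) / t + C * t)) \<longlongrightarrow> ?m * (real CARD('n) * c + C * 0)) (at_right 0)"
    by (intro tendsto_intros)
  moreover have "\<forall>\<^sub>F t in at_right 0. ?I \<le> ?m * (((1 + t * c) ^ CARD('n) - 1) / t + C * t)"
    using eventually_at_right_less[of 0] eventually_at_rightI[OF _ \<delta>, of "\<lambda>t. t < \<delta>"] bound
    by (auto elim!: eventually_elim2)
  ultimately have "?I \<le> ?m * (real CARD('n) * c + C * 0)"
    by (rule tendsto_lowerbound) simp
  then show ?thesis by (simp add: mult_ac)
qed

section \<open>Transfer to an arbitrary finite index type\<close>

text \<open>Lebesgue measure is determined by its values on boxes, and relabelling the coordinates
  only reorders the side lengths in the product.\<close>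

lemma lborel_distr_permute_coordinates:
  fixes \<pi> :: "'m::finite \<Rightarrow> 'n::finite"
  assumes "bij \<pi>"
  shows "distr lborel borel (\<lambda>x::real^'n. \<chi> j. x $ \<pi> j) = (lborel :: (real^'m) measure)"
proof (rule lborel_eqI[symmetric])
  let ?\<phi> = "\<lambda>x::real^'n. \<chi> j. x $ \<pi> j"
  have [measurable]: "?\<phi> \<in> borel \<rightarrow>\<^sub>M borel"
    by (intro borel_measurable_continuous_onI continuous_intros)
  fix l u :: "real^'m"
  assume le: "\<And>b. b \<in> Basis \<Longrightarrow> l \<bullet> b \<le> u \<bullet> b"
  have inv: "\<pi> (inv \<pi> i) = i" "inv \<pi> (\<pi> j) = j" for i j
    using assms by (simp_all add: bij_inv_eq_iff bij_is_surj surj_f_inv_f bij_is_inj)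
  let ?\<psi> = "\<lambda>y::real^'m. \<chi> i. y $ inv \<pi> i"
  have le': "l $ i \<le> u $ i" for i using le[of "axis i 1"] by (simp add: inner_axis axis_in_Basis_iff)
  have "(\<forall>j. l $ j < x $ \<pi> j \<and> x $ \<pi> j < u $ j) \<longleftrightarrow>
      (\<forall>i. l $ inv \<pi> i < x $ i \<and> x $ i < u $ inv \<pi> i)" for x :: "real^'n"
    using inv by metis
  then have "?\<phi> -` box l u = box (?\<psi> l) (?\<psi> u)"
    by (simp add: set_eq_iff mem_box_cart)
  then have "emeasure (distr lborel borel ?\<phi>) (box l u) = emeasure lborel (box (?\<psi> l) (?\<psi> u))"
    by (subst emeasure_distr) simp_all
  also have "\<dots> = ennreal (\<Prod>b\<in>Basis. (?\<psi> u - ?\<psi> l) \<bullet> b)"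
    by (rule emeasure_lborel_box) (auto simp: Basis_vec_def inner_axis le')
  also have "(\<Prod>b\<in>Basis. (?\<psi> u - ?\<psi> l) \<bullet> b) = (\<Prod>i\<in>UNIV. u $ inv \<pi> i - l $ inv \<pi> i)"
    by (simp add: Basis_vec_def prod.reindex inj_on_def axis_eq_axis UNION_singleton_eq_range inner_axis)
  also have "\<dots> = (\<Prod>j\<in>UNIV. u $ j - l $ j)"
    using assms bij_imp_bij_inv prod.reindex_bij_betw[of "inv \<pi>" UNIV UNIV "\<lambda>j. u $ j - l $ j"] by blast
  also have "\<dots> = (\<Prod>b\<in>Basis. (u - l) \<bullet> b)"
    by (simp add: Basis_vec_def prod.reindex inj_on_def axis_eq_axis UNION_singleton_eq_range inner_axis)
  finally show "emeasure (distr lborel borel ?\<phi>) (box l u) = (\<Prod>b\<in>Basis. (u - l) \<bullet> b)" .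
qed simp


text \<open>Conjugating \<open>\<sigma>\<close> by the relabelling \<open>\<phi>\<close>, a linear
  measure-preserving isometry, carries hypotheses and conclusion over to the ordered index
  type.\<close>

lemma integral_trace_derivative_le:
  fixes K :: "(real^'n::finite) set" and \<sigma> :: "real^'n \<Rightarrow> real^'n"
  assumes K: "open K" "convex K" "bounded K"
    and der: "\<And>x. x \<in> K \<Longrightarrow> (\<sigma> has_derivative \<sigma>' x) (at x)"
    and bd: "\<And>x v. x \<in> K \<Longrightarrow> norm (\<sigma>' x v) \<le> B * norm v"
    and int: "set_integrable lborel K (\<lambda>x. trace (matrix (\<sigma>' x)))"
    and c: "0 \<le> c"
    and incl: "\<And>t. 0 < t \<Longrightarrow> \<exists>v. (\<lambda>x. x + t *\<^sub>R \<sigma> x) ` K \<subseteq> (\<lambda>x. (1 + t * c) *\<^sub>R x + v) ` K"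
  shows "(LINT x:K|lborel. trace (matrix (\<sigma>' x))) \<le> real CARD('n) * c * measure lborel K"
proof -
  obtain \<pi> :: "'n ordered_index \<Rightarrow> 'n" where \<pi>: "bij \<pi>" using ex_bij_ordered_index by blast
  define \<phi> :: "real^'n \<Rightarrow> real^'n ordered_index" where "\<phi> x = (\<chi> j. x $ \<pi> j)" for x
  define \<psi> :: "real^'n ordered_index \<Rightarrow> real^'n" where "\<psi> y = (\<chi> i. y $ inv \<pi> i)" for y
  have inv: "\<pi> (inv \<pi> i) = i" "inv \<pi> (\<pi> j) = j" for i j
    using \<pi> by (simp_all add: bij_is_surj surj_f_inv_f bij_is_inj)
  have \<phi>\<psi>[simp]: "\<phi> (\<psi> y) = y" "\<psi> (\<phi> x) = x" for x y
    by (simp_all add: \<phi>_def \<psi>_def inv)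
  have lin: "linear \<phi>" "linear \<psi>"
    by (auto simp: linear_iff \<phi>_def \<psi>_def vec_eq_iff)
  then have blin: "bounded_linear \<phi>" "bounded_linear \<psi>"
    by (simp_all add: linear_conv_bounded_linear)
  have norm_\<phi>: "norm (\<phi> x) = norm x" for x
    unfolding norm_vec_def L2_set_def \<phi>_def
    using sum.reindex_bij_betw[OF \<pi>, of "\<lambda>i. (norm (x $ i))\<^sup>2"] by simp
  have norm_\<psi>: "norm (\<psi> y) = norm y" for y using norm_\<phi>[of "\<psi> y"] by simp
  have \<psi>_axis: "\<psi> (axis j 1) = axis (\<pi> j) 1" for j
    by (auto simp: \<psi>_def axis_def vec_eq_iff inv)
  have distr: "distr lborel borel \<psi> = lborel"
    using lborel_distr_permute_coordinates[OF bij_imp_bij_inv[OF \<pi>]] by (simp add: \<psi>_def[abs_def])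
  have [measurable]: "\<psi> \<in> borel \<rightarrow>\<^sub>M borel"
    using blin by (intro borel_measurable_continuous_onI linear_continuous_on)
  define K2 where "K2 = \<psi> -` K"
  have K2_eq: "K2 = \<phi> ` K" unfolding K2_def by (auto simp: image_iff) (metis \<phi>\<psi>(1))
  have K2: "open K2" "convex K2" "bounded K2"
    using K lin blin linear_continuous_on[OF blin(2), of UNIV]
    by (auto simp: K2_eq bounded_linear_image convex_linear_image)
       (metis K2_def K2_eq open_vimage)
  define \<tau> where "\<tau> y = \<phi> (\<sigma> (\<psi> y))" for y
  define \<tau>' where "\<tau>' y v = \<phi> (\<sigma>' (\<psi> y) (\<psi> v))" for y v
  \<comment> \<open>Conjugation by a coordinate relabelling permutes the diagonal entries, so their
    sum is unchanged.\<close>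
  have tr: "trace (matrix (\<tau>' y)) = trace (matrix (\<sigma>' (\<psi> y)))" for y
    using sum.reindex_bij_betw[OF \<pi>, of "\<lambda>i. \<sigma>' (\<psi> y) (axis i 1) $ i"]
    by (simp add: trace_def matrix_def \<tau>'_def \<psi>_axis) (simp add: \<phi>_def)
  let ?f = "\<lambda>x. indicator K x *\<^sub>R trace (matrix (\<sigma>' x))"
  have f: "integrable lborel ?f" using int unfolding set_integrable_def .
  then have fm: "?f \<in> borel_measurable borel" using borel_measurable_integrable by fastforce
  have comp: "?f (\<psi> y) = indicator K2 y *\<^sub>R trace (matrix (\<tau>' y))" for y
    by (simp add: tr K2_def indicator_def)
  have "integrable (distr lborel borel \<psi>) ?f" using f distr by simp
  then have "integrable lborel (\<lambda>y. ?f (\<psi> y))" by (subst (asm) integrable_distr_eq) (use fm in simp_all)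
  then have int2: "set_integrable lborel K2 (\<lambda>y. trace (matrix (\<tau>' y)))"
    unfolding set_integrable_def comp .
  have "(\<integral>x. ?f x \<partial>lborel) = (\<integral>x. ?f x \<partial>distr lborel borel \<psi>)" using distr by simp
  also have "\<dots> = (\<integral>y. ?f (\<psi> y) \<partial>lborel)" by (intro integral_distr) (use fm in simp_all)
  finally have LINT: "(LINT x:K|lborel. trace (matrix (\<sigma>' x))) = (LINT y:K2|lborel. trace (matrix (\<tau>' y)))"
    unfolding set_lebesgue_integral_def comp .
  have "emeasure lborel K = emeasure (distr lborel borel \<psi>) K" using distr by simp
  also have "\<dots> = emeasure lborel K2" using K by (subst emeasure_distr) (simp_all add: K2_def borel_open)
  finally have meas_K: "measure lborel K = measure lebesgue K2"
    using K2 by (simp add: measure_def borel_open)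
  have "integral K2 (\<lambda>y. trace (matrix (\<tau>' y))) \<le> real CARD('n ordered_index) * c * measure lebesgue K2"
  proof (rule integral_trace_derivative_le_wellorder[OF K2, where \<sigma> = \<tau> and B = B])
    show "(\<tau> has_derivative \<tau>' y) (at y)" if "y \<in> K2" for y
    proof -
      have "(\<sigma> has_derivative \<sigma>' (\<psi> y)) (at (\<psi> y))" using der that by (simp add: K2_def)
      moreover have "(\<psi> has_derivative \<psi>) (at y)" using blin(2) by (rule bounded_linear_imp_has_derivative)
      moreover have "(\<phi> has_derivative \<phi>) (at (\<sigma> (\<psi> y)))" using blin(1) by (rule bounded_linear_imp_has_derivative)
      ultimately have "((\<phi> \<circ> (\<sigma> \<circ> \<psi>)) has_derivative (\<phi> \<circ> (\<sigma>' (\<psi> y) \<circ> \<psi>))) (at y)"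
        by (intro diff_chain_at) (simp_all)
      then show ?thesis by (simp add: \<tau>_def[abs_def] \<tau>'_def[abs_def] o_def)
    qed
    show "norm (\<tau>' y v) \<le> B * norm v" if "y \<in> K2" for y v
      using bd[of "\<psi> y" "\<psi> v"] that by (simp add: \<tau>'_def norm_\<phi> norm_\<psi> K2_def)
    show "(\<lambda>y. trace (matrix (\<tau>' y))) integrable_on K2"
      using set_borel_integral_eq_integral(1)[OF int2] .
    fix t :: real assume "0 < t"
    then obtain v where v: "(\<lambda>x. x + t *\<^sub>R \<sigma> x) ` K \<subseteq> (\<lambda>x. (1 + t * c) *\<^sub>R x + v) ` K"
      using incl by blast
    have "y + t *\<^sub>R \<tau> y \<in> (\<lambda>y. (1 + t * c) *\<^sub>R y + \<phi> v) ` K2" if "y \<in> K2" for y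
    proof -
      obtain x where x: "x \<in> K" "\<psi> y + t *\<^sub>R \<sigma> (\<psi> y) = (1 + t * c) *\<^sub>R x + v"
        using v \<open>y \<in> K2\<close> unfolding K2_def by blast
      have "\<phi> (\<psi> y + t *\<^sub>R \<sigma> (\<psi> y)) = y + t *\<^sub>R \<tau> y"
        using lin(1) by (simp add: linear_add linear_scale \<tau>_def)
      moreover have "\<phi> ((1 + t * c) *\<^sub>R x + v) = (1 + t * c) *\<^sub>R \<phi> x + \<phi> v"
        using lin(1) by (simp add: linear_add linear_scale)
      ultimately have "y + t *\<^sub>R \<tau> y = (1 + t * c) *\<^sub>R \<phi> x + \<phi> v" using x by simp
      moreover have "\<phi> x \<in> K2" using x by (simp add: K2_eq)
      ultimately show ?thesis by blast
    qed
    then show "\<exists>v. (\<lambda>y. y + t *\<^sub>R \<tau> y) ` K2 \<subseteq> (\<lambda>y. (1 + t * c) *\<^sub>R y + v) ` K2" by blast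
  qed (use c in auto)
  then show ?thesis
    unfolding LINT meas_K set_borel_integral_eq_integral(2)[OF int2]
    using bij_betw_same_card[OF \<pi>] by simp
qed

subsection \<open>Cutoff functions and the divergence\<close>

text \<open>The squared positive part is a C^1 function vanishing on a half-line, the building block
  of the cutoff. At \<open>0\<close> its difference quotient is bounded by
  \<open>\<bar>s\<bar>\<close>.\<close>

lemma has_real_derivative_max_square:
  "((\<lambda>s::real. (max 0 s)\<^sup>2) has_real_derivative 2 * max 0 s) (at s)"
proof -
  consider "s < 0" | "s > 0" | "s = 0" by linarith
  then show ?thesis
  proof cases
    case 1
    have "((\<lambda>s::real. 0) has_real_derivative 2 * max 0 s) (at s)" using 1 by simp
    then show ?thesis
      by (rule has_field_derivative_transform_within_open[where S = "{..<0}"]) (use 1 in auto)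
  next
    case 2
    have "((\<lambda>s::real. s\<^sup>2) has_real_derivative 2 * max 0 s) (at s)"
      using 2 by (auto intro!: derivative_eq_intros)
    then show ?thesis
      by (rule has_field_derivative_transform_within_open[where S = "{0<..}"]) (use 2 in auto)
  next
    case 3
    have "((\<lambda>s::real. (max 0 s)\<^sup>2 / s) \<longlongrightarrow> 0) (at 0)"
    proof (rule Lim_null_comparison)
      show "\<forall>\<^sub>F s::real in at 0. norm ((max 0 s)\<^sup>2 / s) \<le> \<bar>s\<bar>"
        by (auto simp: eventually_at_filter max_def power2_eq_square)
      show "((\<lambda>s::real. \<bar>s\<bar>) \<longlongrightarrow> 0) (at 0)" by (auto intro!: tendsto_eq_intros)
    qed
    then show ?thesis using 3 by (simp add: has_field_derivative_iff)
  qed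
qed

text \<open>A sum \<open>S\<close> of radial bumps over a finite cover of \<open>K\<close> is at
  least \<open>\<eta>\<close> on \<open>K\<close> and zero at distance \<open>\<delta>\<close> or
  more from \<open>K\<close>. Composing with a C^1 profile that sends \<open>0\<close> to
  \<open>0\<close> and everything from \<open>\<eta>\<close> on to \<open>1\<close> gives the
  cutoff.\<close>

lemma bump_function_exists:
  fixes K :: "'a::euclidean_space set"
  assumes "compact K" "0 < \<delta>"
  obtains \<phi> :: "'a \<Rightarrow> real" and g where
    "\<And>x. (\<phi> has_derivative (\<lambda>v. g x \<bullet> v)) (at x)" "continuous_on UNIV g"
    "\<And>x. 0 \<le> \<phi> x" "\<And>x. \<phi> x \<le> 1" "\<And>x. x \<in> K \<Longrightarrow> \<phi> x = 1"
    "\<And>x. \<phi> x \<noteq> 0 \<Longrightarrow> \<exists>y\<in>K. dist x y < \<delta>"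
proof -
  let ?q = "\<lambda>s::real. (max 0 s)\<^sup>2"
  obtain D where D: "D \<subseteq> K" "finite D" "K \<subseteq> (\<Union>c\<in>D. ball c (\<delta> / 2))"
    using compactE_image[OF assms(1), of K "\<lambda>c. ball c (\<delta> / 2)"] assms(2)
    by (metis (no_types, lifting) UN_iff centre_in_ball half_gt_zero open_ball subsetI)
  \<comment> \<open>A point within \<open>\<delta> / 2\<close> of a centre has
    \<open>\<delta>^2 - |x - c|^2\<close> at least \<open>3 / 4 * \<delta>^2\<close>; its square is
    the lower bound for \<open>S\<close> on \<open>K\<close>.\<close>
  define \<eta> where "\<eta> = (3 / 4 * \<delta>\<^sup>2)\<^sup>2"
  have \<eta>: "0 < \<eta>" using assms(2) by (simp add: \<eta>_def)
  define S where "S x = (\<Sum>c\<in>D. ?q (\<delta>\<^sup>2 - (x - c) \<bullet> (x - c)))" for x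
  define S' where "S' x = (\<Sum>c\<in>D. (2 * max 0 (\<delta>\<^sup>2 - (x - c) \<bullet> (x - c)) * -2) *\<^sub>R (x - c))" for x
  define \<phi> where "\<phi> x = 1 - ?q (1 - S x / \<eta>)" for x
  define g where "g x = (2 * max 0 (1 - S x / \<eta>) / \<eta>) *\<^sub>R S' x" for x
  have S: "0 \<le> S x" for x unfolding S_def by (intro sum_nonneg) auto
  have qd: "(?q has_derivative (\<lambda>v. 2 * max 0 s * v)) (at s)" for s
    using has_real_derivative_max_square[of s] by (simp add: has_field_derivative_def)
  have dS: "(S has_derivative (\<lambda>v. S' x \<bullet> v)) (at x)" for x
  proof -
    have "((\<lambda>x. ?q (\<delta>\<^sup>2 - (x - c) \<bullet> (x - c))) has_derivative
        (\<lambda>v. 2 * max 0 (\<delta>\<^sup>2 - (x - c) \<bullet> (x - c)) * (- 2 * ((x - c) \<bullet> v)))) (at x)" for c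
      by (rule has_derivative_compose[OF _ qd])
         (auto intro!: derivative_eq_intros simp: inner_commute)
    then have "(S has_derivative
        (\<lambda>v. \<Sum>c\<in>D. 2 * max 0 (\<delta>\<^sup>2 - (x - c) \<bullet> (x - c)) * (- 2 * ((x - c) \<bullet> v)))) (at x)"
      unfolding S_def[abs_def] by (rule has_derivative_sum)
    then show ?thesis by (simp add: S'_def inner_sum_left mult.assoc)
  qed
  have "((\<lambda>x. 1 - S x / \<eta>) has_derivative (\<lambda>v. 0 - S' x \<bullet> v / \<eta>)) (at x)" for x
    by (intro has_derivative_diff has_derivative_const
        bounded_linear.has_derivative[OF bounded_linear_divide dS])
  then have "((\<lambda>x. ?q (1 - S x / \<eta>)) has_derivative (\<lambda>v. 2 * max 0 (1 - S x / \<eta>) * (0 - S' x \<bullet> v / \<eta>))) (at x)" for x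
    by (rule has_derivative_compose[OF _ qd])
  from has_derivative_diff[OF has_derivative_const this]
  have d\<phi>: "(\<phi> has_derivative (\<lambda>v. g x \<bullet> v)) (at x)" for x
    by (simp add: \<phi>_def[abs_def] g_def)
  have contS: "continuous_on UNIV S" "continuous_on UNIV S'"
    unfolding S_def[abs_def] S'_def[abs_def] by (intro continuous_intros)+
  have contg: "continuous_on UNIV g"
    unfolding g_def[abs_def] by (intro continuous_intros contS) (use \<eta> in auto)
  have le1: "1 - S x / \<eta> \<le> 1" for x using S[of x] \<eta> by simp
  show ?thesis
  proof
    show "\<phi> x \<le> 1" for x by (simp add: \<phi>_def)
    show "0 \<le> \<phi> x" for x
      using le1[of x] power_le_one[of "max 0 (1 - S x / \<eta>)" 2] by (simp add: \<phi>_def)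
    show "\<phi> x = 1" if "x \<in> K" for x
    proof -
      obtain c where c: "c \<in> D" "dist c x < \<delta> / 2" using D(3) \<open>x \<in> K\<close> by fastforce
      then have "(norm (x - c))\<^sup>2 \<le> (\<delta> / 2)\<^sup>2"
        by (intro power_mono) (auto simp: dist_norm norm_minus_commute)
      then have "3 / 4 * \<delta>\<^sup>2 \<le> \<delta>\<^sup>2 - (x - c) \<bullet> (x - c)"
        by (simp add: power2_norm_eq_inner power_divide)
      also have "\<dots> \<le> max 0 (\<delta>\<^sup>2 - (x - c) \<bullet> (x - c))" by simp
      finally have "3 / 4 * \<delta>\<^sup>2 \<le> max 0 (\<delta>\<^sup>2 - (x - c) \<bullet> (x - c))" .
      then have "\<eta> \<le> ?q (\<delta>\<^sup>2 - (x - c) \<bullet> (x - c))" unfolding \<eta>_def by (intro power_mono) auto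
      also have "\<dots> \<le> S x" unfolding S_def using c D
        by (intro member_le_sum[of c D "\<lambda>c. ?q (\<delta>\<^sup>2 - (x - c) \<bullet> (x - c))"]) auto
      finally have "1 - S x / \<eta> \<le> 0" using \<eta> by simp
      then show ?thesis by (simp add: \<phi>_def)
    qed
    show "\<exists>y\<in>K. dist x y < \<delta>" if "\<phi> x \<noteq> 0" for x
    proof (rule ccontr)
      assume *: "\<not> (\<exists>y\<in>K. dist x y < \<delta>)"
      have "max 0 (\<delta>\<^sup>2 - (x - c) \<bullet> (x - c)) = 0" if "c \<in> D" for c
      proof -
        have "\<delta> \<le> norm (x - c)" using * that D by (force simp: dist_norm)
        then have "\<delta>\<^sup>2 \<le> (norm (x - c))\<^sup>2" using assms by (intro power_mono) auto
        then show ?thesis by (simp add: power2_norm_eq_inner)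
      qed
      then have "S x = 0" by (simp add: S_def)
      then show False using that by (simp add: \<phi>_def)
    qed
  qed (fact d\<phi> contg)+
qed

section \<open>C^1 maps and the divergence as a trace\<close>

lemma C_1_onI:
  assumes "\<And>x. (f has_derivative f' x) (at x)" "\<And>v. continuous_on UNIV (\<lambda>x. f' x v)"
  shows "C_k_on 1 f UNIV"
proof -
  have "continuous_on UNIV f"
    using assms(1) by (meson continuous_at_imp_continuous_on has_derivative_continuous)
  moreover have "partial_deriv i f = (\<lambda>x. f' x (axis i 1))" for i
    using frechet_derivative_at[OF assms(1)] by (auto simp: partial_deriv_def fun_eq_iff)
  ultimately have "continuous_on UNIV (iterated_partial js f)" if "length js \<le> 1" for js
    using that assms(2) by (cases js) auto
  then show ?thesis
    unfolding C_k_on_def using assms(1) by (auto simp: differentiable_def)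
qed

lemma C_1_onD:
  assumes "C_k_on 1 f UNIV"
  shows "(f has_derivative frechet_derivative f (at x)) (at x)"
    and "continuous_on UNIV (partial_deriv i f)"
proof -
  have "iterated_partial [] f differentiable at x"
    using assms unfolding C_k_on_def by blast
  then show "(f has_derivative frechet_derivative f (at x)) (at x)"
    by (simp add: frechet_derivative_works)
  have "continuous_on UNIV (iterated_partial [i] f)"
    using assms unfolding C_k_on_def by (metis le_numeral_extra(4) length_Cons list.size(3) One_nat_def)
  then show "continuous_on UNIV (partial_deriv i f)" by simp
qed

lemma divergence_eq_trace:
  assumes "(\<sigma> has_derivative \<sigma>') (at x)"
  shows "divergence \<sigma> x = trace (matrix \<sigma>')"
proof -
  have "((\<lambda>y. \<sigma> y $ i) has_derivative (\<lambda>v. \<sigma>' v $ i)) (at x)" for i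
    using bounded_linear.has_derivative[OF bounded_linear_vec_nth assms] .
  from frechet_derivative_at[OF this]
  have "frechet_derivative (\<lambda>y. \<sigma> y $ i) (at x) v = \<sigma>' v $ i" for i v
    by (metis (no_types, lifting))
  then show ?thesis by (simp add: divergence_def partial_deriv_def trace_def matrix_def)
qed

subsection \<open>Wulff shapes\<close>

locale aniso_norm =
  fixes F :: "real^'n::finite \<Rightarrow> real" and a :: real
  assumes convex: "convex_on UNIV F"
    and homogeneous: "F (t *\<^sub>R \<xi>) = \<bar>t\<bar> * F \<xi>"
    and a: "0 < a"
    and lower: "a * norm \<xi> \<le> F \<xi>"
begin

section \<open>The polar function as a norm\<close>

lemma F_pos: "\<xi> \<noteq> 0 \<Longrightarrow> 0 < F \<xi>"
  using lower[of \<xi>] a by (smt (verit) mult_pos_pos zero_less_norm_iff)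

text \<open>Cauchy-Schwarz and \<open>lower\<close> bound the quotients defining
  \<open>polar\<close>, so its real supremum is a genuine one.\<close>

lemma quotient_le_norm: "\<xi> \<noteq> 0 \<Longrightarrow> (\<xi> \<bullet> v) / F \<xi> \<le> norm v / a"
proof -
  assume \<xi>: "\<xi> \<noteq> 0"
  have "a * (\<xi> \<bullet> v) \<le> a * (norm \<xi> * norm v)"
    using a norm_cauchy_schwarz[of \<xi> v] by simp
  also have "\<dots> \<le> F \<xi> * norm v"
    using mult_right_mono[OF lower[of \<xi>], of "norm v"] by (simp add: mult.assoc)
  finally show ?thesis using F_pos[OF \<xi>] a by (simp add: field_simps)
qed

lemma polar_upper: "\<xi> \<noteq> 0 \<Longrightarrow> (\<xi> \<bullet> v) / F \<xi> \<le> polar F v"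
  unfolding polar_def
  by (rule cSUP_upper) (auto intro!: bdd_aboveI2 quotient_le_norm)

lemma polar_least:
  assumes "\<And>\<xi>. \<xi> \<noteq> 0 \<Longrightarrow> (\<xi> \<bullet> v) / F \<xi> \<le> c"
  shows "polar F v \<le> c"
proof -
  \<comment> \<open>Any nonzero vector will do: the supremum must range over a nonempty set.\<close>
  have "axis undefined 1 \<in> - {0 :: real^'n}" by (simp add: axis_eq_0_iff)
  then show ?thesis unfolding polar_def by (intro cSUP_least) (use assms in auto)
qed

lemma polar_le_norm: "polar F v \<le> norm v / a"
  by (intro polar_least quotient_le_norm)

lemma polar_triangle: "polar F (v + w) \<le> polar F v + polar F w"
  by (rule polar_least) (simp add: inner_add_right add_divide_distrib add_mono polar_upper)

lemma polar_minus [simp]: "polar F (- v) = polar F v"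
proof -
  have le: "polar F (- v) \<le> polar F v" for v
  proof (rule polar_least)
    fix \<xi> :: "real^'n" assume "\<xi> \<noteq> 0"
    then show "\<xi> \<bullet> - v / F \<xi> \<le> polar F v"
      using polar_upper[of "- \<xi>" v] homogeneous[of "-1" \<xi>] by simp
  qed
  show ?thesis using le[of v] le[of "- v"] by simp
qed

lemma polar_0 [simp]: "polar F 0 = 0"
  using polar_le_norm[of 0] polar_triangle[of 0 0] by simp

lemma polar_nonneg: "0 \<le> polar F v"
  using polar_triangle[of v "- v"] by simp

lemma polar_scale: "0 \<le> t \<Longrightarrow> polar F (t *\<^sub>R v) = t * polar F v"
proof -
  have le: "polar F (t *\<^sub>R v) \<le> t * polar F v" if "0 \<le> t" for t v
    using that by (intro polar_least) (simp add: mult_left_mono polar_upper flip: times_divide_eq_right)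
  assume "0 \<le> t"
  moreover have "t * polar F v \<le> polar F (t *\<^sub>R v)" if "0 < t"
    using le[of "1 / t" "t *\<^sub>R v"] that by (simp add: field_simps)
  ultimately show ?thesis using le[of t v] by (cases "t = 0") auto
qed

text \<open>By compactness \<open>F\<close> has a maximum \<open>F u\<close> on the unit sphere, so
  \<open>F v\<close> is at most \<open>F u * norm v\<close>; testing the supremum with
  \<open>v\<close> itself gives the constant \<open>1 / F u\<close>. This is what bounds Wulff
  shapes.\<close>

lemma polar_lower: "\<exists>b>0. \<forall>v. b * norm v \<le> polar F v"
proof -
  have "continuous_on (sphere 0 1) F"
    using convex_on_continuous[OF open_UNIV convex] continuous_on_subset by blast
  moreover have "sphere (0 :: real^'n) 1 \<noteq> {}" by simp
  ultimately obtain u where u: "u \<in> sphere 0 1" "\<And>v. v \<in> sphere 0 1 \<Longrightarrow> F v \<le> F u"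
    using continuous_attains_sup[of "sphere 0 1" F] by auto
  have u0: "0 < F u" using u by (intro F_pos) auto
  have "1 / F u * norm v \<le> polar F v" for v
  proof (cases "v = 0")
    case False
    have "F v = norm v * F ((1 / norm v) *\<^sub>R v)" using False homogeneous[of "1 / norm v" v] by simp
    also have "\<dots> \<le> norm v * F u" using False by (intro mult_left_mono u) auto
    finally have "F v \<le> norm v * F u" .
    then have "norm v * F v \<le> F u * (v \<bullet> v)"
      using mult_left_mono[of "F v" "norm v * F u" "norm v"]
      by (simp add: mult_ac power2_eq_square flip: power2_norm_eq_inner)
    then have "1 / F u * norm v \<le> (v \<bullet> v) / F v"
      using u0 F_pos[OF False] by (simp add: field_simps)
    then show ?thesis using polar_upper[OF False, of v] by linarith
  qed (simp add: polar_nonneg)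
  then show ?thesis using u0 by (intro exI[of _ "1 / F u"]) auto
qed

lemma convex_on_polar: "convex_on UNIV (polar F)"
proof (rule convex_onI)
  fix t :: real and x y :: "real^'n" assume "0 < t" "t < 1"
  then show "polar F ((1 - t) *\<^sub>R x + t *\<^sub>R y) \<le> (1 - t) * polar F x + t * polar F y"
    using polar_triangle[of "(1 - t) *\<^sub>R x" "t *\<^sub>R y"] by (simp add: polar_scale)
qed simp

lemma continuous_on_polar: "continuous_on A (polar F)"
  using convex_on_continuous[OF open_UNIV convex_on_polar] continuous_on_subset by blast

lemma continuous_on_polar_diff: "continuous_on A (\<lambda>x. polar F (x - x0))"
  by (intro continuous_on_compose2[OF continuous_on_polar[of UNIV]] continuous_intros) auto

section \<open>Topology of Wulff shapes\<close>

lemma open_wulff_shape: "open (wulff_shape F r x0)"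
  unfolding wulff_shape_def
  by (intro open_Collect_less continuous_on_polar_diff continuous_intros)

lemma convex_wulff_shape: "convex (wulff_shape F r x0)"
proof (rule convexI)
  fix x y :: "real^'n" and u v :: real
  assume *: "x \<in> wulff_shape F r x0" "y \<in> wulff_shape F r x0" "0 \<le> u" "0 \<le> v" "u + v = 1"
  have "u *\<^sub>R x + v *\<^sub>R y - x0 = u *\<^sub>R (x - x0) + v *\<^sub>R (y - x0)"
    using *(5) by (simp add: algebra_simps flip: scaleR_left_distrib)
  then have "polar F (u *\<^sub>R x + v *\<^sub>R y - x0) \<le> u * polar F (x - x0) + v * polar F (y - x0)"
    using polar_triangle[of "u *\<^sub>R (x - x0)" "v *\<^sub>R (y - x0)"] * by (simp add: polar_scale)
  also have "\<dots> < r" using * unfolding wulff_shape_def by (intro convex_bound_lt) auto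
  finally show "u *\<^sub>R x + v *\<^sub>R y \<in> wulff_shape F r x0" by (simp add: wulff_shape_def)
qed

lemma bounded_wulff_shape: "bounded (wulff_shape F r x0)"
proof -
  obtain b where b: "0 < b" "\<And>v. b * norm v \<le> polar F v" using polar_lower by blast
  have "wulff_shape F r x0 \<subseteq> cball x0 (r / b)"
  proof
    fix x assume "x \<in> wulff_shape F r x0"
    then have "b * norm (x - x0) \<le> r" using b(2)[of "x - x0"] by (simp add: wulff_shape_def)
    then show "x \<in> cball x0 (r / b)"
      using b(1) by (simp add: dist_norm norm_minus_commute field_simps)
  qed
  then show ?thesis using bounded_cball bounded_subset by blast
qed

lemma center_in_wulff_shape: "0 < r \<Longrightarrow> x0 \<in> wulff_shape F r x0"
  by (simp add: wulff_shape_def)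

lemma closure_wulff_shape: "x \<in> closure (wulff_shape F r x0) \<Longrightarrow> polar F (x - x0) \<le> r"
proof -
  have "closed {x. polar F (x - x0) \<le> r}"
    by (intro closed_Collect_le continuous_on_polar_diff continuous_intros)
  then have "closure (wulff_shape F r x0) \<subseteq> {x. polar F (x - x0) \<le> r}"
    by (intro closure_minimal) (auto simp: wulff_shape_def)
  then show "x \<in> closure (wulff_shape F r x0) \<Longrightarrow> polar F (x - x0) \<le> r" by auto
qed


subsection \<open>Perimeter and Cheeger constant\<close>

text \<open>The volume comparison applies with \<open>c = 1 / r\<close>, because dilating by
  \<open>1 + t / r\<close> enlarges the radius from \<open>r\<close> to
  \<open>r + t\<close>.\<close>

lemma perimeter_wulff_shape_le:
  assumes r: "0 < r"
  shows "aniso_perimeter F (wulff_shape F r x0)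
    \<le> ennreal (real CARD('n) / r * measure lborel (wulff_shape F r x0))"
  unfolding aniso_perimeter_def
proof (rule SUP_least, clarify)
  let ?W = "wulff_shape F r x0"
  fix \<sigma> :: "real^'n \<Rightarrow> real^'n"
  assume C1: "C_k_on 1 \<sigma> UNIV" and le1: "\<forall>x. polar F (\<sigma> x) \<le> 1"
  define \<sigma>' where "\<sigma>' x = frechet_derivative \<sigma> (at x)" for x
  have der: "(\<sigma> has_derivative \<sigma>' x) (at x)" for x
    using C_1_onD(1)[OF C1] by (simp add: \<sigma>'_def)
  have cont: "continuous_on A (\<lambda>x. \<sigma>' x (axis i 1))" for i A
    using C_1_onD(2)[OF C1, of i] continuous_on_subset
    by (auto simp: partial_deriv_def[abs_def] \<sigma>'_def)
  have div: "divergence \<sigma> x = trace (matrix (\<sigma>' x))" for x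
    by (rule divergence_eq_trace[OF der])
  have cont_div: "continuous_on A (divergence \<sigma>)" for A
    unfolding div[abs_def] trace_def matrix_def by (auto intro!: continuous_intros cont)
  have comp: "compact (closure ?W)" using bounded_wulff_shape by (simp add: compact_closure)
  \<comment> \<open>The partial derivatives are continuous, hence bounded on the compact closure;
    their bounds add up to a bound for the whole derivative.\<close>
  have "\<exists>b. \<forall>x\<in>closure ?W. norm (\<sigma>' x (axis i 1)) \<le> b" for i
    using compact_imp_bounded[OF compact_continuous_image[OF cont comp], of i]
    by (auto simp: bounded_iff)
  then obtain b where b: "\<And>i x. x \<in> closure ?W \<Longrightarrow> norm (\<sigma>' x (axis i 1)) \<le> b i" by metis
  have bd: "norm (\<sigma>' x v) \<le> (\<Sum>i\<in>UNIV. b i) * norm v" if "x \<in> ?W" for x v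
  proof -
    have x: "x \<in> closure ?W" using that closure_subset by blast
    have "\<sigma>' x v = \<sigma>' x (\<Sum>i\<in>UNIV. v $ i *\<^sub>R axis i 1)"
      by (simp add: basis_expansion flip: scalar_mult_eq_scaleR)
    also have "\<dots> = (\<Sum>i\<in>UNIV. v $ i *\<^sub>R \<sigma>' x (axis i 1))"
      using has_derivative_linear[OF der] by (simp add: linear_sum linear_scale)
    also have "norm \<dots> \<le> (\<Sum>i\<in>UNIV. b i * norm v)"
    proof (rule sum_norm_le)
      fix i
      have "\<bar>v $ i\<bar> * norm (\<sigma>' x (axis i 1)) \<le> norm v * b i"
        using b[OF x, of i] component_le_norm_cart[of v i] by (intro mult_mono) auto
      then show "norm (v $ i *\<^sub>R \<sigma>' x (axis i 1)) \<le> b i * norm v" by (simp add: mult.commute)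
    qed
    finally show ?thesis by (simp add: sum_distrib_right)
  qed
  have "set_integrable lborel (closure ?W) (divergence \<sigma>)"
    unfolding set_integrable_def using comp cont_div by (rule borel_integrable_compact)
  then have int: "set_integrable lborel ?W (divergence \<sigma>)"
    by (rule set_integrable_subset) (use open_wulff_shape closure_subset in auto)
  have incl: "\<exists>v. (\<lambda>x. x + t *\<^sub>R \<sigma> x) ` ?W \<subseteq> (\<lambda>x. (1 + t * (1 / r)) *\<^sub>R x + v) ` ?W" if t: "0 < t" for t
  proof (intro exI subsetI, clarify)
    fix x assume x: "x \<in> ?W"
    let ?s = "1 + t * (1 / r)"
    have s: "0 < ?s" using t r by (simp add: add_pos_pos)
    \<comment> \<open>The preimage of the moved point under the dilation by \<open>?s\<close>
      centred at \<open>x0\<close>; the translation vector is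
      \<open>x0 - ?s *\<^sub>R x0\<close>.\<close>
    define y where "y = x0 + (1 / ?s) *\<^sub>R (x - x0 + t *\<^sub>R \<sigma> x)"
    have "polar F (x - x0 + t *\<^sub>R \<sigma> x) \<le> polar F (x - x0) + t * polar F (\<sigma> x)"
      using polar_triangle[of "x - x0" "t *\<^sub>R \<sigma> x"] t by (simp add: polar_scale)
    also have "\<dots> < r + t * 1"
      using x le1 t by (intro add_less_le_mono mult_left_mono) (auto simp: wulff_shape_def)
    also have "\<dots> = ?s * r" using r by (simp add: field_simps)
    finally have "polar F (y - x0) < r"
      using s by (simp add: y_def polar_scale pos_divide_less_eq mult.commute)
    then have "y \<in> ?W" by (simp add: wulff_shape_def)
    moreover have "x + t *\<^sub>R \<sigma> x = ?s *\<^sub>R y + (x0 - ?s *\<^sub>R x0)"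
      using s by (simp add: y_def scaleR_add_right del: scaleR_left_distrib)
    ultimately show "x + t *\<^sub>R \<sigma> x \<in> (\<lambda>x. ?s *\<^sub>R x + (x0 - ?s *\<^sub>R x0)) ` ?W" by blast
  qed
  have "(LINT x:?W|lebesgue. divergence \<sigma> x) = (LINT x:?W|lborel. divergence \<sigma> x)"
    unfolding set_lebesgue_integral_def
    using int unfolding set_integrable_def
    by (intro integral_completion) (simp add: borel_measurable_integrable)
  also have "\<dots> \<le> real CARD('n) * (1 / r) * measure lborel ?W"
    unfolding div
    by (rule integral_trace_derivative_le[OF open_wulff_shape convex_wulff_shape bounded_wulff_shape der bd])
      (use int r incl in \<open>auto simp: div[abs_def]\<close>)
  finally show "ennreal (LINT x:?W|lebesgue. divergence \<sigma> x) \<le> ennreal (real CARD('n) / r * measure lborel ?W)"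
    by (intro ennreal_leI) simp
qed

lemma emeasure_wulff_shape:
  assumes "0 < r"
  shows "emeasure lebesgue (wulff_shape F r x0) = ennreal (measure lborel (wulff_shape F r x0))"
    and "0 < measure lborel (wulff_shape F r x0)"
proof -
  let ?W = "wulff_shape F r x0"
  have W: "?W \<in> sets borel" using open_wulff_shape by (simp add: borel_open)
  have fin: "emeasure lborel ?W < \<infinity>" using emeasure_bounded_finite[OF bounded_wulff_shape] .
  then show eq: "emeasure lebesgue ?W = ennreal (measure lborel ?W)"
    using W by (simp add: emeasure_eq_ennreal_measure)
  have "\<not> negligible ?W"
    using open_not_negligible[OF open_wulff_shape] center_in_wulff_shape[OF assms] by blast
  then have "emeasure lebesgue ?W \<noteq> 0"
    using W by (auto simp: negligible_iff_null_sets null_sets_def)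
  then show "0 < measure lborel ?W" unfolding eq by (simp add: zero_less_measure_iff ennreal_eq_0_iff)
qed

section \<open>Upper bound for a general set\<close>

lemma cheeger_le_of_wulff_shape_subset:
  assumes r: "0 < r" and sub: "wulff_shape F r x0 \<subseteq> \<Omega>"
  shows "aniso_cheeger F \<Omega> \<le> ennreal (real CARD('n) / r)"
proof -
  let ?W = "wulff_shape F r x0" and ?m = "measure lborel (wulff_shape F r x0)"
  note m = emeasure_wulff_shape[OF r, of x0]
  have "?W \<in> sets lebesgue" using open_wulff_shape by (simp add: borel_open)
  then have "aniso_cheeger F \<Omega> \<le> aniso_perimeter F ?W / emeasure lebesgue ?W"
    unfolding aniso_cheeger_def using sub m by (intro INF_lower) auto
  also have "\<dots> \<le> ennreal (real CARD('n) / r * ?m) / ennreal ?m"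
    unfolding m(1) by (intro divide_right_mono_ennreal perimeter_wulff_shape_le r)
  also have "\<dots> = ennreal (real CARD('n) / r)"
    using m(2) r by (simp add: divide_ennreal)
  finally show ?thesis .
qed

text \<open>A Wulff shape is connected, so if it contains a point of \<open>\<Omega>\<close> without
  lying inside \<open>\<Omega>\<close> it meets the frontier, at a point too close to
  \<open>x\<close>.\<close>

lemma wulff_shape_subset:
  assumes \<Omega>: "x \<in> \<Omega>" "r \<le> aniso_dist F \<Omega> x"
  shows "wulff_shape F r x \<subseteq> \<Omega>"
proof (rule ccontr)
  assume not_sub: "\<not> wulff_shape F r x \<subseteq> \<Omega>"
  then obtain z where "z \<in> wulff_shape F r x" by blast
  then have "0 < r" using polar_nonneg[of "z - x"] by (simp add: wulff_shape_def)
  then have "wulff_shape F r x \<inter> frontier \<Omega> \<noteq> {}"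
    using \<Omega>(1) center_in_wulff_shape[of r x] not_sub
    by (intro connected_Int_frontier convex_connected convex_wulff_shape) blast+
  then obtain y where y: "y \<in> frontier \<Omega>" "polar F (y - x) < r" by (auto simp: wulff_shape_def)
  have "aniso_dist F \<Omega> x \<le> polar F (x - y)"
    unfolding aniso_dist_def using y(1) by (intro cINF_lower bdd_belowI2[of _ 0] polar_nonneg)
  then show False using y(2) \<Omega>(2) polar_minus[of "y - x"] by simp
qed

lemma cheeger_le:
  "aniso_cheeger F \<Omega> \<le> of_nat CARD('n) / aniso_inradius F \<Omega>"
proof (cases "aniso_inradius F \<Omega> = 0")
  case True
  then show ?thesis by (simp add: ennreal_divide_zero)
next
  case False
  have "aniso_cheeger F \<Omega> * ennreal (aniso_dist F \<Omega> x) \<le> of_nat CARD('n)" if x: "x \<in> \<Omega>" for x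
  proof (cases "0 < aniso_dist F \<Omega> x")
    case True
    then have "aniso_cheeger F \<Omega> \<le> ennreal (real CARD('n) / aniso_dist F \<Omega> x)"
      using x by (intro cheeger_le_of_wulff_shape_subset wulff_shape_subset) auto
    then have "aniso_cheeger F \<Omega> * ennreal (aniso_dist F \<Omega> x)
        \<le> ennreal (real CARD('n) / aniso_dist F \<Omega> x) * ennreal (aniso_dist F \<Omega> x)"
      by (rule mult_right_mono) simp
    also have "\<dots> = of_nat CARD('n)"
      using True by (simp flip: ennreal_mult add: ennreal_of_nat_eq_real_of_nat)
    finally show ?thesis .
  qed (simp add: ennreal_neg)
  then have le: "aniso_cheeger F \<Omega> * aniso_inradius F \<Omega> \<le> of_nat CARD('n)"
    unfolding aniso_inradius_def SUP_mult_left_ennreal by (rule SUP_least)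
  show ?thesis
  proof (cases "aniso_inradius F \<Omega> = top")
    case True
    \<comment> \<open>With infinite inradius, \<open>le\<close> forces the Cheeger constant to be
      \<open>0\<close>, as a positive one would make the product infinite.\<close>
    then show ?thesis using le by (cases "aniso_cheeger F \<Omega> = 0") (auto simp: ennreal_mult_top top_unique)
  next
    case fin: False
    have "aniso_cheeger F \<Omega> = aniso_cheeger F \<Omega> * aniso_inradius F \<Omega> / aniso_inradius F \<Omega>"
      using False fin by (simp add: ennreal_mult_divide_eq)
    also have "\<dots> \<le> of_nat CARD('n) / aniso_inradius F \<Omega>"
      using le by (rule divide_right_mono_ennreal)
    finally show ?thesis .
  qed
qed

section \<open>Lower bound and equality for Wulff shapes\<close>

lemma ex_radial_field:
  assumes r: "0 < r" and \<epsilon>: "0 < \<epsilon>" "\<epsilon> < 1"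
  obtains \<sigma> where "C_k_on 1 \<sigma> UNIV" "compact (closure {x. \<sigma> x \<noteq> 0})" "\<And>x. polar F (\<sigma> x) \<le> 1"
    "\<And>x. x \<in> wulff_shape F r x0 \<Longrightarrow> divergence \<sigma> x = (1 - \<epsilon>) * (real CARD('n) / r)"
proof -
  let ?W = "wulff_shape F r x0"
  define c where "c = (1 - \<epsilon>) / r"
  define \<delta> where "\<delta> = a * r * \<epsilon> / (1 - \<epsilon>)"
  have c: "0 < c" and \<delta>: "0 < \<delta>" using r \<epsilon> a by (simp_all add: c_def \<delta>_def)
  have c_le: "c * (r + \<delta> / a) = 1"
    using r \<epsilon> a by (simp add: c_def \<delta>_def field_simps)
  have "compact (closure ?W)" using bounded_wulff_shape by (simp add: compact_closure)
  then obtain \<phi> g where \<phi>: "\<And>x. (\<phi> has_derivative (\<lambda>v. g x \<bullet> v)) (at x)" "continuous_on UNIV g"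
    "\<And>x. 0 \<le> \<phi> x" "\<And>x. \<phi> x \<le> 1" "\<And>x. x \<in> closure ?W \<Longrightarrow> \<phi> x = 1"
    "\<And>x. \<phi> x \<noteq> 0 \<Longrightarrow> \<exists>y\<in>closure ?W. dist x y < \<delta>"
    using bump_function_exists[OF _ \<delta>, of "closure ?W"] by metis
  have near: "polar F (x - x0) < r + \<delta> / a" if \<phi>x: "\<phi> x \<noteq> 0" for x
  proof -
    obtain y where y: "y \<in> closure ?W" "dist x y < \<delta>" using \<phi>(6)[OF \<phi>x] by blast
    have "polar F (x - x0) \<le> polar F (y - x0) + polar F (x - y)"
      using polar_triangle[of "y - x0" "x - y"] by (simp add: algebra_simps)
    also have "\<dots> \<le> r + norm (x - y) / a"
      using closure_wulff_shape[OF y(1)] polar_le_norm[of "x - y"] by linarith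
    also have "\<dots> < r + \<delta> / a" using y(2) a by (simp add: dist_norm divide_strict_right_mono)
    finally show ?thesis .
  qed
  define \<sigma> where "\<sigma> x = (c * \<phi> x) *\<^sub>R (x - x0)" for x
  have cont_\<phi>: "continuous_on UNIV \<phi>"
    using \<phi>(1) by (meson continuous_at_imp_continuous_on has_derivative_continuous)
  show ?thesis
  proof
    have "(\<sigma> has_derivative (\<lambda>v. (c * \<phi> x) *\<^sub>R (v - 0) + (c * (g x \<bullet> v)) *\<^sub>R (x - x0))) (at x)" for x
      unfolding \<sigma>_def[abs_def]
      by (intro has_derivative_scaleR has_derivative_diff has_derivative_ident has_derivative_const
          has_derivative_mult_right \<phi>(1))
    then show "C_k_on 1 \<sigma> UNIV"
      by (rule C_1_onI) (intro continuous_intros cont_\<phi> \<phi>(2))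
    have "{x. \<sigma> x \<noteq> 0} \<subseteq> wulff_shape F (r + \<delta> / a) x0"
      using near by (auto simp: \<sigma>_def wulff_shape_def)
    then show "compact (closure {x. \<sigma> x \<noteq> 0})"
      using bounded_wulff_shape bounded_subset by (simp add: compact_closure) blast
    show "polar F (\<sigma> x) \<le> 1" for x
    proof (cases "\<phi> x = 0")
      case False
      have "polar F (\<sigma> x) = \<phi> x * (c * polar F (x - x0))"
        using c \<phi>(3)[of x] by (simp add: \<sigma>_def polar_scale)
      also have "\<dots> \<le> 1 * (c * (r + \<delta> / a))"
        using c \<phi>(3,4)[of x] near[OF False] polar_nonneg[of "x - x0"] by (intro mult_mono) auto
      finally show ?thesis using c_le by simp
    qed (simp add: \<sigma>_def)
    show "divergence \<sigma> x = (1 - \<epsilon>) * (real CARD('n) / r)" if x: "x \<in> ?W" for x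
    proof -
      \<comment> \<open>On the open Wulff shape the cutoff equals \<open>1\<close>, so the field is
        affine there and its derivative is \<open>c\<close> times the identity, of trace
        \<open>c * N\<close>.\<close>
      have "((\<lambda>y. c *\<^sub>R (y - x0)) has_derivative (\<lambda>v. c *\<^sub>R (v - 0))) (at x)"
        by (intro has_derivative_scaleR_right has_derivative_diff has_derivative_ident has_derivative_const)
      then have "(\<sigma> has_derivative (\<lambda>v. c *\<^sub>R (v - 0))) (at x)"
      proof (rule has_derivative_transform_within_open[OF _ open_wulff_shape x])
        fix y assume "y \<in> ?W"
        then have "\<phi> y = 1" using \<phi>(5) closure_subset by blast
        then show "c *\<^sub>R (y - x0) = \<sigma> y" by (simp add: \<sigma>_def)
      qed
      from divergence_eq_trace[OF this] show ?thesis
        by (simp add: trace_def matrix_def c_def)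
    qed
  qed
qed

text \<open>The radial field has the same constant divergence on every competitor \<open>K\<close>,
  so testing with it bounds the perimeter below by that constant times the volume of
  \<open>K\<close>; then \<open>\<epsilon>\<close> tends to \<open>0\<close>.\<close>

lemma le_cheeger_wulff_shape:
  assumes r: "0 < r"
  shows "ennreal (real CARD('n) / r) \<le> aniso_cheeger F (wulff_shape F r x0)"
  unfolding aniso_cheeger_def
proof (rule INF_greatest, clarify)
  fix K :: "(real^'n) set"
  assume K: "K \<in> sets lebesgue" "K \<subseteq> wulff_shape F r x0" "0 < emeasure lebesgue K"
  define m where "m = measure lebesgue K"
  have Km: "K \<in> lmeasurable"
    using K bounded_wulff_shape bounded_subset bounded_set_imp_lmeasurable by blast
  then have em: "emeasure lebesgue K = ennreal m" by (simp add: m_def emeasure_eq_measure2)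
  then have m: "0 < m" using K(3) by simp
  have le: "ennreal ((1 - \<epsilon>) * (real CARD('n) / r) * m) \<le> aniso_perimeter F K"
    if \<epsilon>: "0 < \<epsilon>" "\<epsilon> < 1" for \<epsilon>
  proof -
    obtain \<sigma> where \<sigma>: "C_k_on 1 \<sigma> UNIV" "compact (closure {x. \<sigma> x \<noteq> 0})" "\<And>x. polar F (\<sigma> x) \<le> 1"
      "\<And>x. x \<in> wulff_shape F r x0 \<Longrightarrow> divergence \<sigma> x = (1 - \<epsilon>) * (real CARD('n) / r)"
      using ex_radial_field[OF r \<epsilon>] by blast
    have "(LINT x:K|lebesgue. divergence \<sigma> x) = (LINT x:K|lebesgue. (1 - \<epsilon>) * (real CARD('n) / r))"
      using K \<sigma>(4) by (intro set_lebesgue_integral_cong) auto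
    also have "\<dots> = (1 - \<epsilon>) * (real CARD('n) / r) * m"
      using Km by (simp add: set_lebesgue_integral_def m_def fmeasurable_def)
    finally show ?thesis
      unfolding aniso_perimeter_def using \<sigma>(1-3)
      by (intro SUP_upper2[of \<sigma>]) auto
  qed
  have "((\<lambda>\<epsilon>. ennreal ((1 - \<epsilon>) * (real CARD('n) / r) * m)) \<longlongrightarrow> ennreal ((1 - 0) * (real CARD('n) / r) * m)) (at_right 0)"
    by (intro tendsto_intros)
  moreover have "\<forall>\<^sub>F \<epsilon> in at_right 0. ennreal ((1 - \<epsilon>) * (real CARD('n) / r) * m) \<le> aniso_perimeter F K"
    by (rule eventually_at_rightI[of 0 1]) (use le in auto)
  ultimately have "ennreal ((1 - 0) * (real CARD('n) / r) * m) \<le> aniso_perimeter F K"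
    by (rule tendsto_upperbound) simp
  then have "ennreal (real CARD('n) / r * m) / ennreal m \<le> aniso_perimeter F K / ennreal m"
    by (intro divide_right_mono_ennreal) simp
  then show "ennreal (real CARD('n) / r) \<le> aniso_perimeter F K / emeasure lebesgue K"
    using m r by (simp add: em divide_ennreal)
qed

text \<open>Evaluating the distance at the centre suffices. This direction gives
  \<open>N / R \<le> N / r\<close> in the equality case.\<close>

lemma le_inradius_wulff_shape:
  assumes r: "0 < r"
  shows "ennreal r \<le> aniso_inradius F (wulff_shape F r x0)"
proof -
  let ?W = "wulff_shape F r x0"
  have "?W \<noteq> UNIV" using bounded_wulff_shape not_bounded_UNIV by metis
  \<comment> \<open>Nonemptiness is required to bound an infimum of reals from below.\<close>
  then have "frontier ?W \<noteq> {}"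
    using center_in_wulff_shape[OF r] by (intro frontier_not_empty) auto
  moreover have "r \<le> polar F (x0 - y)" if "y \<in> frontier ?W" for y
  proof -
    have "y \<notin> ?W" using that open_wulff_shape by (auto simp: frontier_def interior_open)
    then show ?thesis using polar_minus[of "y - x0"] by (simp add: wulff_shape_def)
  qed
  ultimately have "r \<le> aniso_dist F ?W x0" unfolding aniso_dist_def by (rule cINF_greatest)
  then show ?thesis
    unfolding aniso_inradius_def using center_in_wulff_shape[OF r]
    by (intro SUP_upper2[of x0] ennreal_leI) auto
qed

text \<open>With the general inequality in one direction, the other is the chain from
  \<open>N / R\<close> through \<open>N / r\<close> to the Cheeger constant.\<close>

lemma cheeger_wulff_shape:
  assumes r: "0 < r"
  shows "aniso_cheeger F (wulff_shape F r x0) = of_nat CARD('n) / aniso_inradius F (wulff_shape F r x0)"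
proof (rule antisym[OF cheeger_le])
  let ?R = "aniso_inradius F (wulff_shape F r x0)"
  have R: "ennreal r \<le> ?R" by (rule le_inradius_wulff_shape[OF r])
  have "of_nat CARD('n) = ennreal r * ennreal (real CARD('n) / r)"
    using r by (simp flip: ennreal_mult add: ennreal_of_nat_eq_real_of_nat)
  also have "\<dots> \<le> ?R * ennreal (real CARD('n) / r)" using R by (rule mult_right_mono) simp
  finally have "of_nat CARD('n) / ?R \<le> ennreal (real CARD('n) / r)"
    using R r by (intro divide_le_posI_ennreal) (auto intro: less_le_trans[of 0 "ennreal r"])
  also have "\<dots> \<le> aniso_cheeger F (wulff_shape F r x0)" by (rule le_cheeger_wulff_shape[OF r])
  finally show "of_nat CARD('n) / aniso_inradius F (wulff_shape F r x0) \<le> aniso_cheeger F (wulff_shape F r x0)" .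
qed

end

theorem proposition3p3:
  fixes F :: "real^'n::finite \<Rightarrow> real" and p a \<beta> :: real
  assumes "CARD('n) \<ge> 2"
    and "1 < p"
    and "\<And>\<xi>. 0 \<le> F \<xi>"
    and "convex_on UNIV F"
    and "\<And>t \<xi>. F (t *\<^sub>R \<xi>) = \<bar>t\<bar> * F \<xi>"
    and "0 < a" and "\<And>\<xi>. a * norm \<xi> \<le> F \<xi>"
    and "0 < \<beta>" and "\<beta> \<le> 1" and "C_k_holder_on 3 \<beta> F (-{0})"
    and "\<And>\<xi>. \<xi> \<noteq> 0 \<Longrightarrow> positive_definite (hessian (\<lambda>\<eta>. F \<eta> powr p) \<xi>)"
  shows "(\<forall>\<Omega>. open \<Omega> \<and> bounded \<Omega> \<longrightarrow>
            aniso_cheeger F \<Omega> \<le> of_nat CARD('n) / aniso_inradius F \<Omega>) \<and>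
         (\<forall>r x0. 0 < r \<longrightarrow>
            aniso_cheeger F (wulff_shape F r x0)
              = of_nat CARD('n) / aniso_inradius F (wulff_shape F r x0))"
proof -
  interpret aniso_norm F a by unfold_locales (fact assms)+
  show ?thesis using cheeger_le cheeger_wulff_shape by blast
qed

end
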